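(* Let $(X,d)$ be a compact metric space, $T:X\to X$ continuous, and $A\in C^0(X)$. Let $\varphi\in C^0(X,\mathbb R^n)$ and $h\in\mathrm{int}(\varphi_*(\mathcal M_T))$. If $\{\varphi_j\}\subset C^0(X,\mathbb R^n)$ is a sequence converging to $\varphi$ in the sup norm, then $\lim_{j\to\infty}\beta_{A,\varphi_j}(h)=\beta_{A,\varphi}(h)$.
   Context: $\mathcal M_T$ is the set of $T$-invariant Borel probability measures on $X$. For $\psi=(\psi_1,\dots,\psi_n)\in C^0(X,\mathbb R^n)$, $\psi_*:\mathcal M_T\to\mathbb R^n$ is $\psi_*(\mu)=\left(\int\psi_1\,d\mu,\dots,\int\psi_n\,d\mu\right)$. For $h\in\psi_*(\mathcal M_T)$, $\beta_{A,\psi}(h)=\sup\{\int A\,d\mu:\mu\in\mathcal M_T,\ \psi_*(\mu)=h\}$. $\mathrm{int}$ denotes the interior in $\mathbb R^n$. Since $h$ is interior, one has $h\in\mathrm{int}((\varphi_j)_*(\mathcal M_T))$ for all sufficiently large $j$, so $\beta_{A,\varphi_j}(h)$ is defined for all sufficiently large $j$; the limit is understood over such $j$. *)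

theory Defs
  imports "HOL-Probability.Probability"
begin

(* The compact metric space is a compact subset X of a metric_space type, carrying the
   restriction of dist; its Borel sigma-algebra is restrict_space borel X. *)

definition invariant_measures ::
  "'a::metric_space set \<Rightarrow> ('a \<Rightarrow> 'a) \<Rightarrow> 'a measure set" where
  "invariant_measures X T =
     {\<mu>. prob_space \<mu> \<and> sets \<mu> = sets (restrict_space borel X) \<and>
        (\<forall>B\<in>sets \<mu>. emeasure \<mu> (T -` B \<inter> X) = emeasure \<mu> B)}"

definition rotation_vector ::
  "('a \<Rightarrow> real ^ 'n) \<Rightarrow> 'a measure \<Rightarrow> real ^ 'n" where
  "rotation_vector \<psi> \<mu> = (\<chi> i. \<integral>x. \<psi> x $ i \<partial>\<mu>)"

(* Meaningful for A and \<psi> continuous on compact X and h in the image of the invariant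
   measures under rotation_vector \<psi>; the set below is then nonempty and bounded.
   Outside that range the value of the real supremum carries no information. *)
definition beta_function ::
  "'a::metric_space set \<Rightarrow> ('a \<Rightarrow> 'a) \<Rightarrow> ('a \<Rightarrow> real) \<Rightarrow> ('a \<Rightarrow> real ^ 'n) \<Rightarrow> real ^ 'n \<Rightarrow> real" where
  "beta_function X T A \<psi> h =
     Sup {\<integral>x. A x \<partial>\<mu> | \<mu>. \<mu> \<in> invariant_measures X T \<and> rotation_vector \<psi> \<mu> = h}"

end

theory Submission
  imports Defs
begin

text \<open>
  The continuity of the beta function in the potential is a consequence of the convexity of the
  set of invariant measures.

  Let \<open>\<phi>\<close> and \<open>\<psi>\<close> be potentials at sup-distance at most \<open>\<delta>\<close>, and suppose that the rotation set of
  \<open>\<psi>\<close> contains a ball of radius \<open>r\<close> about \<open>h\<close>. An invariant measure \<open>\<mu>\<close> with \<open>\<phi>\<close>-rotation vector \<open>h\<close>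
  has a \<open>\<psi>\<close>-rotation vector \<open>h + e\<close> with \<open>norm e \<le> \<delta>\<close>. The error \<open>e\<close> is repaired by mixing \<open>\<mu>\<close>
  with an invariant measure \<open>\<nu>\<close> whose \<open>\<psi>\<close>-rotation vector lies on the opposite side of \<open>h\<close>, at
  distance at most \<open>r\<close>: a weight of order \<open>\<delta> / r\<close> on \<open>\<nu>\<close> suffices. The integral of the bounded
  function \<open>A\<close> changes by \<open>O(\<delta> / r)\<close> in this way, so the beta function of \<open>\<psi>\<close> at \<open>h\<close> is at least
  that of \<open>\<phi>\<close> up to this error (\<open>beta_function_perturbed_le\<close>). Exchanging
  \<open>\<phi>\<close> and \<open>\<psi>\<close> gives the opposite inequality if the rotation set of \<open>\<phi>\<close> contains such a ball as
  well. For the limit potential the ball exists because \<open>h\<close> is interior, and for nearby potentials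
  a ball of half the radius survives: the perturbed rotation set is convex and comes within \<open>\<delta>\<close> of
  every point of the original ball, hence fills the ball up to a margin \<open>\<delta>\<close>
  (\<open>ball_subset_rotation_set_perturbed\<close>).
\<close>

section \<open>Invariant measures\<close>

lemma invariant_measures_simps:
  assumes "\<mu> \<in> invariant_measures X T"
  shows "prob_space \<mu>" and "sets \<mu> = sets (restrict_space borel X)" and "space \<mu> = X"
proof -
  show "prob_space \<mu>" and s: "sets \<mu> = sets (restrict_space borel X)"
    using assms by (auto simp: invariant_measures_def)
  show "space \<mu> = X"
    using sets_eq_imp_space_eq[OF s] by (simp add: space_restrict_space)
qed

lemma integrable_invariant_measure:
  fixes f :: "'a::metric_space \<Rightarrow> 'b::euclidean_space"
  assumes X: "compact X" and f: "continuous_on X f" and \<mu>: "\<mu> \<in> invariant_measures X T"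
  shows "integrable \<mu> f"
proof -
  interpret prob_space \<mu> using invariant_measures_simps(1)[OF \<mu>] .
  have "bounded (f ` X)"
    using compact_continuous_image[OF f X] by (rule compact_imp_bounded)
  then obtain B where B: "\<And>x. x \<in> X \<Longrightarrow> norm (f x) \<le> B"
    by (auto simp: bounded_iff)
  have "f \<in> borel_measurable \<mu>"
    using borel_measurable_continuous_on_restrict[OF f] invariant_measures_simps(2)[OF \<mu>]
    by (simp cong: measurable_cong_sets)
  then show ?thesis
    by (intro integrable_const_bound[where B=B]) (auto simp: invariant_measures_simps(3)[OF \<mu>] B)
qed

lemma norm_integral_invariant_measure_le:
  fixes f :: "'a::metric_space \<Rightarrow> 'b::euclidean_space"
  assumes X: "compact X" and f: "continuous_on X f" and \<mu>: "\<mu> \<in> invariant_measures X T"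
    and B: "\<And>x. x \<in> X \<Longrightarrow> norm (f x) \<le> B"
  shows "norm (\<integral>x. f x \<partial>\<mu>) \<le> B"
proof -
  interpret prob_space \<mu> using invariant_measures_simps(1)[OF \<mu>] .
  have "norm (\<integral>x. f x \<partial>\<mu>) \<le> (\<integral>x. norm (f x) \<partial>\<mu>)"
    by (rule integral_norm_bound)
  also have "\<dots> \<le> B"
    using integrable_invariant_measure[OF X f \<mu>]
    by (intro integral_le_const) (auto simp: invariant_measures_simps(3)[OF \<mu>] B)
  finally show ?thesis .
qed

lemma rotation_vector_eq_integral:
  fixes \<psi> :: "'a::metric_space \<Rightarrow> real ^ 'n"
  assumes "compact X" and "continuous_on X \<psi>" and "\<mu> \<in> invariant_measures X T"
  shows "rotation_vector \<psi> \<mu> = (\<integral>x. \<psi> x \<partial>\<mu>)"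
  using integral_bounded_linear[OF bounded_linear_vec_nth integrable_invariant_measure[OF assms]]
  by (simp add: rotation_vector_def vec_eq_iff)

lemma norm_rotation_vector_diff_le:
  fixes \<psi> \<phi> :: "'a::metric_space \<Rightarrow> real ^ 'n"
  assumes X: "compact X" and \<psi>: "continuous_on X \<psi>" and \<phi>: "continuous_on X \<phi>"
    and \<mu>: "\<mu> \<in> invariant_measures X T"
    and \<delta>: "\<And>x. x \<in> X \<Longrightarrow> norm (\<psi> x - \<phi> x) \<le> \<delta>"
  shows "norm (rotation_vector \<psi> \<mu> - rotation_vector \<phi> \<mu>) \<le> \<delta>"
proof -
  have "rotation_vector \<psi> \<mu> - rotation_vector \<phi> \<mu> = (\<integral>x. \<psi> x - \<phi> x \<partial>\<mu>)"
    by (simp add: rotation_vector_eq_integral[OF X \<psi> \<mu>] rotation_vector_eq_integral[OF X \<phi> \<mu>]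
        integrable_invariant_measure[OF X \<psi> \<mu>] integrable_invariant_measure[OF X \<phi> \<mu>])
  then show ?thesis
    using norm_integral_invariant_measure_le[OF X continuous_on_diff[OF \<psi> \<phi>] \<mu> \<delta>] by simp
qed

section \<open>Convexity\<close>

text \<open>
  The mixture is realized as the law of a point drawn from \<open>\<mu>\<close> or \<open>\<nu>\<close> according to a coin toss with
  bias \<open>t\<close>, so that its values on sets and its integrals come from the Giry monad.
\<close>

lemma invariant_measures_mixture:
  fixes X :: "'a::metric_space set"
  assumes X: "compact X" and T: "continuous_on X T" "T \<in> X \<rightarrow> X"
    and \<mu>: "\<mu> \<in> invariant_measures X T" and \<nu>: "\<nu> \<in> invariant_measures X T"
    and t: "0 \<le> t" "t \<le> (1::real)"
  obtains \<kappa> where "\<kappa> \<in> invariant_measures X T"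
    and "\<And>f :: 'a \<Rightarrow> real. continuous_on X f \<Longrightarrow>
           (\<integral>x. f x \<partial>\<kappa>) = t * (\<integral>x. f x \<partial>\<mu>) + (1 - t) * (\<integral>x. f x \<partial>\<nu>)"
proof -
  let ?R = "restrict_space borel X"
  define N where "N = (\<lambda>b. if b then \<mu> else \<nu>)"
  define \<kappa> where "\<kappa> = measure_pmf (bernoulli_pmf t) \<bind> N"
  have N_inv: "N b \<in> invariant_measures X T" for b
    using \<mu> \<nu> by (simp add: N_def)
  note N_simps = invariant_measures_simps[OF N_inv]
  have N: "N \<in> measurable (measure_pmf (bernoulli_pmf t)) (subprob_algebra ?R)"
    by (auto simp: space_subprob_algebra N_simps intro!: prob_space_imp_subprob_space)
  have sets: "sets \<kappa> = sets ?R"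
    unfolding \<kappa>_def using N by (intro sets_bind_measurable) auto
  have emeasure: "emeasure \<kappa> B = emeasure \<mu> B * t + emeasure \<nu> B * (1 - t)" if "B \<in> sets ?R" for B
    unfolding \<kappa>_def using emeasure_bind[OF _ N that] t by (simp add: N_def)
  have Tm: "T \<in> measurable ?R ?R"
    using T by (intro measurable_restrict_space2 borel_measurable_continuous_on_restrict)
      (auto simp: space_restrict_space)
  have "\<kappa> \<in> invariant_measures X T"
    unfolding invariant_measures_def
  proof (intro CollectI conjI ballI)
    show "prob_space \<kappa>"
      unfolding \<kappa>_def
      by (rule measure_pmf.prob_space_bind[OF _ N]) (simp add: N_simps)
    show "sets \<kappa> = sets ?R" by (rule sets)
    fix B assume "B \<in> sets \<kappa>"
    then have B: "B \<in> sets ?R" by (simp add: sets)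
    have TB: "T -` B \<inter> X \<in> sets ?R"
      using measurable_sets[OF Tm B] by (simp add: space_restrict_space)
    have "emeasure (N b) (T -` B \<inter> X) = emeasure (N b) B" for b
      using N_inv[of b] B by (simp add: invariant_measures_def)
    from this[of True] this[of False] show "emeasure \<kappa> (T -` B \<inter> X) = emeasure \<kappa> B"
      by (simp add: emeasure[OF B] emeasure[OF TB] N_def)
  qed
  moreover have "(\<integral>x. f x \<partial>\<kappa>) = t * (\<integral>x. f x \<partial>\<mu>) + (1 - t) * (\<integral>x. f x \<partial>\<nu>)"
    if f: "continuous_on X f" for f :: "'a \<Rightarrow> real"
  proof -
    have mass: "emeasure (N b) (space (N b)) \<le> ennreal 1" for b
      using prob_space.emeasure_space_1[OF N_simps(1)] by simp
    have "bounded (f ` X)"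
      using compact_continuous_image[OF f X] by (rule compact_imp_bounded)
    then obtain B where B: "\<And>x. x \<in> X \<Longrightarrow> \<bar>f x\<bar> \<le> B"
      by (auto simp: bounded_iff)
    have "(\<integral>x. f x \<partial>\<kappa>) = (\<integral>b. \<integral>x. f x \<partial>N b \<partial>measure_pmf (bernoulli_pmf t))"
      unfolding \<kappa>_def
      by (rule integral_bind[where K="?R" and B=B and B'=1])
        (use N B borel_measurable_continuous_on_restrict[OF f] mass in
          \<open>auto simp: space_restrict_space simp del: ennreal_1 measurable_pmf_measure1
            intro!: measure_pmf.finite_measure\<close>)
    then show ?thesis using t by (simp add: N_def mult.commute)
  qed
  ultimately show thesis by (rule that)
qed

lemma rotation_vector_mixture:
  assumes "\<And>i. continuous_on X (\<lambda>x. \<psi> x $ i)"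
    and "\<And>f :: 'a::metric_space \<Rightarrow> real. continuous_on X f \<Longrightarrow>
           (\<integral>x. f x \<partial>\<kappa>) = t * (\<integral>x. f x \<partial>\<mu>) + (1 - t) * (\<integral>x. f x \<partial>\<nu>)"
  shows "rotation_vector \<psi> \<kappa> = t *\<^sub>R rotation_vector \<psi> \<mu> + (1 - t) *\<^sub>R rotation_vector \<psi> \<nu>"
  using assms(2)[OF assms(1)] by (simp add: rotation_vector_def vec_eq_iff)

lemma convex_rotation_set:
  fixes \<psi> :: "'a::metric_space \<Rightarrow> real ^ 'n"
  assumes X: "compact X" and T: "continuous_on X T" "T \<in> X \<rightarrow> X" and \<psi>: "continuous_on X \<psi>"
  shows "convex (rotation_vector \<psi> ` invariant_measures X T)"
proof -
  have "t *\<^sub>R rotation_vector \<psi> \<mu> + (1 - t) *\<^sub>R rotation_vector \<psi> \<nu>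
          \<in> rotation_vector \<psi> ` invariant_measures X T"
    if \<mu>: "\<mu> \<in> invariant_measures X T" and \<nu>: "\<nu> \<in> invariant_measures X T"
      and t: "0 \<le> t" "t \<le> 1" for \<mu> \<nu> t
  proof -
    obtain \<kappa> where \<kappa>: "\<kappa> \<in> invariant_measures X T"
      and "\<And>f :: 'a \<Rightarrow> real. continuous_on X f \<Longrightarrow>
           (\<integral>x. f x \<partial>\<kappa>) = t * (\<integral>x. f x \<partial>\<mu>) + (1 - t) * (\<integral>x. f x \<partial>\<nu>)"
      using invariant_measures_mixture[OF X T \<mu> \<nu> t] by blast
    then have "rotation_vector \<psi> \<kappa> = t *\<^sub>R rotation_vector \<psi> \<mu> + (1 - t) *\<^sub>R rotation_vector \<psi> \<nu>"
      using \<psi> by (intro rotation_vector_mixture continuous_on_component) auto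
    with \<kappa> show ?thesis by (metis image_eqI)
  qed
  then show ?thesis by (auto simp: convex_alt add.commute)
qed

text \<open>
  If a point \<open>p\<close> of the smaller ball were missing from \<open>C\<close>, a hyperplane through \<open>p\<close> would leave
  \<open>C\<close> on one side. Moving from \<open>p\<close> along the normal to the other side reaches a point of \<open>cball h r\<close>
  that is further than \<open>\<delta>\<close> from the hyperplane, and hence from \<open>C\<close>.
\<close>

lemma ball_subset_convex_approx:
  fixes C :: "'a::euclidean_space set"
  assumes C: "convex C" and \<delta>: "0 \<le> \<delta>"
    and approx: "\<And>x. x \<in> cball h r \<Longrightarrow> \<exists>c\<in>C. dist x c \<le> \<delta>"
  shows "ball h (r - \<delta>) \<subseteq> C"
proof
  fix p assume p: "p \<in> ball h (r - \<delta>)"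
  show "p \<in> C"
  proof (rule ccontr)
    assume "p \<notin> C"
    have "0 \<le> r" using p \<delta> zero_le_dist[of h p] by (simp del: zero_le_dist)
    then have "C \<noteq> {}" using approx[of h] by auto
    then obtain a where a: "a \<noteq> 0" "\<And>c. c \<in> C \<Longrightarrow> a \<bullet> c \<le> a \<bullet> p"
      using separating_hyperplane_sets[of C "{p}"] C \<open>p \<notin> C\<close> by fastforce
    define s where "s = r - dist h p"
    define q where "q = p + (s / norm a) *\<^sub>R a"
    have s: "s > \<delta>" using p by (simp add: s_def)
    have "dist p q = s" using a(1) s \<delta> by (simp add: q_def dist_norm)
    then have "q \<in> cball h r" using dist_triangle[of h q p] by (simp add: s_def)
    then obtain c where c: "c \<in> C" "dist q c \<le> \<delta>" using approx by blast
    have "a \<bullet> q = a \<bullet> p + norm a * s"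
      using a(1) by (simp add: q_def inner_add_right dot_square_norm power2_eq_square)
    moreover have "a \<bullet> q - a \<bullet> c \<le> norm a * \<delta>"
    proof -
      have "a \<bullet> q - a \<bullet> c \<le> norm a * norm (q - c)"
        using norm_cauchy_schwarz[of a "q - c"] by (simp add: inner_diff_right)
      also have "\<dots> \<le> norm a * \<delta>"
        using c(2) by (intro mult_left_mono) (auto simp: dist_norm)
      finally show ?thesis .
    qed
    ultimately have "norm a * s \<le> norm a * \<delta>" using a(2)[OF c(1)] by simp
    then show False using s a(1) by simp
  qed
qed

section \<open>Dependence of the rotation set and of the beta function on the potential\<close>

lemma ball_subset_rotation_set_perturbed:
  fixes \<phi> \<psi> :: "'a::metric_space \<Rightarrow> real ^ 'n"
  assumes X: "compact X" and T: "continuous_on X T" "T \<in> X \<rightarrow> X"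
    and \<phi>: "continuous_on X \<phi>" and \<psi>: "continuous_on X \<psi>"
    and \<delta>: "0 \<le> \<delta>" "\<And>x. x \<in> X \<Longrightarrow> norm (\<phi> x - \<psi> x) \<le> \<delta>"
    and r: "cball h r \<subseteq> rotation_vector \<phi> ` invariant_measures X T"
  shows "ball h (r - \<delta>) \<subseteq> rotation_vector \<psi> ` invariant_measures X T"
proof (rule ball_subset_convex_approx[OF convex_rotation_set[OF X T \<psi>] \<delta>(1)])
  fix x assume "x \<in> cball h r"
  then obtain \<mu> where \<mu>: "\<mu> \<in> invariant_measures X T" and x: "x = rotation_vector \<phi> \<mu>"
    using r by blast
  have "dist x (rotation_vector \<psi> \<mu>) \<le> \<delta>"
    using norm_rotation_vector_diff_le[OF X \<phi> \<psi> \<mu> \<delta>(2)] by (simp add: x dist_norm)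
  with \<mu> show "\<exists>c\<in>rotation_vector \<psi> ` invariant_measures X T. dist x c \<le> \<delta>" by blast
qed

text \<open>
  Any competitor \<open>\<mu>\<close> for \<open>\<phi>\<close> becomes a competitor for \<open>\<psi>\<close> after mixing in a little of an invariant
  measure \<open>\<nu>\<close> that compensates the displacement of its rotation vector.
\<close>

lemma beta_function_perturbed_le:
  fixes \<phi> \<psi> :: "'a::metric_space \<Rightarrow> real ^ 'n"
  assumes X: "compact X" and T: "continuous_on X T" "T \<in> X \<rightarrow> X"
    and A: "continuous_on X A" "\<And>x. x \<in> X \<Longrightarrow> norm (A x) \<le> M"
    and \<phi>: "continuous_on X \<phi>" and \<psi>: "continuous_on X \<psi>"
    and \<delta>: "0 \<le> \<delta>" "\<And>x. x \<in> X \<Longrightarrow> norm (\<phi> x - \<psi> x) \<le> \<delta>"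
    and h: "h \<in> rotation_vector \<phi> ` invariant_measures X T"
    and r: "0 < r" "cball h r \<subseteq> rotation_vector \<psi> ` invariant_measures X T"
  shows "beta_function X T A \<phi> h \<le> beta_function X T A \<psi> h + 2 * M * \<delta> / r"
proof -
  have A_bound: "\<bar>\<integral>x. A x \<partial>\<mu>\<bar> \<le> M" if "\<mu> \<in> invariant_measures X T" for \<mu>
    using norm_integral_invariant_measure_le[OF X A(1) that A(2)] by simp
  have le_beta: "(\<integral>x. A x \<partial>\<kappa>) \<le> beta_function X T A \<psi> h"
    if "\<kappa> \<in> invariant_measures X T" "rotation_vector \<psi> \<kappa> = h" for \<kappa>
    unfolding beta_function_def
    by (rule cSup_upper) (use that A_bound in \<open>auto intro!: bdd_aboveI[where M=M] dest: abs_le_D1\<close>)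
  have "(\<integral>x. A x \<partial>\<mu>) \<le> beta_function X T A \<psi> h + 2 * M * \<delta> / r"
    if \<mu>: "\<mu> \<in> invariant_measures X T" and \<mu>h: "rotation_vector \<phi> \<mu> = h" for \<mu>
  proof -
    define e where "e = rotation_vector \<psi> \<mu> - h"
    have e: "norm e \<le> \<delta>"
      using norm_rotation_vector_diff_le[OF X \<phi> \<psi> \<mu> \<delta>(2)]
      by (simp add: e_def \<mu>h norm_minus_commute)
    \<comment> \<open>The target of \<open>\<nu>\<close> is opposite to \<open>e\<close> as seen from \<open>h\<close>. The scaling \<open>r / \<delta>\<close> keeps it within
      the ball because \<open>norm e \<le> \<delta>\<close>; for \<open>\<delta> = 0\<close> it is \<open>h\<close>, by the convention \<open>r / 0 = 0\<close>.\<close>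
    have "h - (r / \<delta>) *\<^sub>R e \<in> cball h r"
    proof (cases "\<delta> = 0")
      case False
      then have "r * norm e / \<delta> \<le> r * \<delta> / \<delta>"
        using e \<delta>(1) r(1) by (intro divide_right_mono mult_left_mono) auto
      then show ?thesis using False \<delta>(1) r(1) by (simp add: dist_norm)
    qed (use r(1) in simp)
    then obtain \<nu> where \<nu>: "\<nu> \<in> invariant_measures X T"
      and \<nu>h: "rotation_vector \<psi> \<nu> = h - (r / \<delta>) *\<^sub>R e"
      using subsetD[OF r(2)] by (metis imageE)
    \<comment> \<open>For \<open>\<delta> > 0\<close> this is the solution of \<open>t * (r / \<delta>) = 1 - t\<close>, which makes the
      contributions of \<open>\<nu>\<close> and \<open>\<mu>\<close> along \<open>e\<close> cancel.\<close>
    define t where "t = \<delta> / (r + \<delta>)"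
    have t: "0 \<le> t" "t \<le> 1" "t \<le> \<delta> / r"
      using r(1) \<delta>(1) by (auto simp: t_def intro!: divide_left_mono)
    obtain \<kappa> where \<kappa>: "\<kappa> \<in> invariant_measures X T"
      and mix: "\<And>f :: 'a \<Rightarrow> real. continuous_on X f \<Longrightarrow>
           (\<integral>x. f x \<partial>\<kappa>) = t * (\<integral>x. f x \<partial>\<nu>) + (1 - t) * (\<integral>x. f x \<partial>\<mu>)"
      using invariant_measures_mixture[OF X T \<nu> \<mu> t(1,2)] by blast
    have "rotation_vector \<psi> \<kappa> = t *\<^sub>R rotation_vector \<psi> \<nu> + (1 - t) *\<^sub>R rotation_vector \<psi> \<mu>"
      using \<psi> mix by (intro rotation_vector_mixture continuous_on_component) auto
    also have "\<dots> = h + (1 - t - t * (r / \<delta>)) *\<^sub>R e"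
      unfolding \<nu>h by (simp add: e_def algebra_simps)
    also have "\<dots> = h"
    proof (cases "\<delta> = 0")
      case False
      then have "1 - t - t * (r / \<delta>) = 0"
        using \<delta>(1) r(1) by (simp add: t_def field_simps add_pos_nonneg)
      then show ?thesis by simp
    qed (use e in simp)
    finally have "(\<integral>x. A x \<partial>\<kappa>) \<le> beta_function X T A \<psi> h" by (rule le_beta[OF \<kappa>])
    moreover have "(\<integral>x. A x \<partial>\<mu>) = (\<integral>x. A x \<partial>\<kappa>) + t * ((\<integral>x. A x \<partial>\<mu>) - (\<integral>x. A x \<partial>\<nu>))"
      by (simp add: mix[OF A(1)] algebra_simps)
    moreover have "t * ((\<integral>x. A x \<partial>\<mu>) - (\<integral>x. A x \<partial>\<nu>)) \<le> \<delta> / r * (2 * M)"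
    proof -
      have "(\<integral>x. A x \<partial>\<mu>) - (\<integral>x. A x \<partial>\<nu>) \<le> 2 * M" "0 \<le> M"
        using A_bound[OF \<mu>] A_bound[OF \<nu>] by linarith+
      then have "t * ((\<integral>x. A x \<partial>\<mu>) - (\<integral>x. A x \<partial>\<nu>)) \<le> t * (2 * M)"
        using t(1) by (intro mult_left_mono)
      also have "\<dots> \<le> \<delta> / r * (2 * M)"
        using t(3) \<open>0 \<le> M\<close> by (intro mult_right_mono) auto
      finally show ?thesis .
    qed
    ultimately show ?thesis by (simp add: mult.commute mult.left_commute)
  qed
  then show ?thesis
    unfolding beta_function_def[of X T A \<phi>] by (intro cSup_least) (use h in auto)
qed

theorem proposition8:
  fixes X :: "'a::metric_space set"
    and T :: "'a \<Rightarrow> 'a"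
    and A :: "'a \<Rightarrow> real"
    and \<phi> :: "'a \<Rightarrow> real ^ 'n"
    and \<phi>s :: "nat \<Rightarrow> 'a \<Rightarrow> real ^ 'n"
    and h :: "real ^ 'n"
  assumes "compact X"
    and "continuous_on X T" and "T \<in> X \<rightarrow> X"
    and "continuous_on X A"
    and "continuous_on X \<phi>"
    and "h \<in> interior (rotation_vector \<phi> ` invariant_measures X T)"
    and "\<And>j. continuous_on X (\<phi>s j)"
    and "uniform_limit X \<phi>s \<phi> sequentially"
  shows "(\<forall>\<^sub>F j in sequentially.
            h \<in> interior (rotation_vector (\<phi>s j) ` invariant_measures X T)) \<and>
         (\<lambda>j. beta_function X T A (\<phi>s j) h) \<longlonglongrightarrow> beta_function X T A \<phi> h"
proof -
  let ?rot = "\<lambda>\<psi>. rotation_vector \<psi> ` invariant_measures X T"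
  note X = assms(1) and T = assms(2,3) and A = assms(4) and \<phi> = assms(5) and \<phi>s = assms(7)
  obtain r where r: "r > 0" "cball h r \<subseteq> ?rot \<phi>"
    using assms(6) by (auto simp: mem_interior_cball)
  have close: "\<forall>\<^sub>F j in sequentially. \<forall>x\<in>X. norm (\<phi> x - \<phi>s j x) \<le> \<delta>" if "\<delta> > 0" for \<delta>
    using uniform_limitD[OF assms(8) that]
    by eventually_elim (auto simp: dist_norm norm_minus_commute intro: less_imp_le)
  have half: "cball h (r / 2) \<subseteq> ?rot (\<phi>s j)"
    if "\<forall>x\<in>X. norm (\<phi> x - \<phi>s j x) \<le> \<delta>" "0 \<le> \<delta>" "\<delta> \<le> r / 4" for j \<delta>
  proof -
    have "cball h (r / 2) \<subseteq> ball h (r - \<delta>)" using that r(1) by auto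
    also have "\<dots> \<subseteq> ?rot (\<phi>s j)"
      using that by (intro ball_subset_rotation_set_perturbed[OF X T \<phi> \<phi>s _ _ r(2)]) auto
    finally show ?thesis .
  qed
  have "\<forall>\<^sub>F j in sequentially. \<forall>x\<in>X. norm (\<phi> x - \<phi>s j x) \<le> r / 4"
    using r(1) by (intro close) simp
  then have "\<forall>\<^sub>F j in sequentially. h \<in> interior (?rot (\<phi>s j))"
  proof eventually_elim
    fix j assume "\<forall>x\<in>X. norm (\<phi> x - \<phi>s j x) \<le> r / 4"
    then have "cball h (r / 2) \<subseteq> ?rot (\<phi>s j)"
      by (rule half) (use r(1) in auto)
    then show "h \<in> interior (?rot (\<phi>s j))"
      unfolding mem_interior_cball using r(1) by (intro exI[of _ "r / 2"]) simp
  qed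
  moreover have "(\<lambda>j. beta_function X T A (\<phi>s j) h) \<longlonglongrightarrow> beta_function X T A \<phi> h"
  proof (rule tendstoI)
    fix \<epsilon> :: real assume \<epsilon>: "\<epsilon> > 0"
    have "bounded (A ` X)"
      using compact_continuous_image[OF A X] by (rule compact_imp_bounded)
    then obtain M where M: "M > 0" "\<And>x. x \<in> X \<Longrightarrow> norm (A x) \<le> M"
      by (auto simp: bounded_pos)
    \<comment> \<open>The first bound preserves a ball of radius \<open>r / 2\<close> in the perturbed rotation sets; with that
      radius the second makes the error term of \<open>beta_function_perturbed_le\<close> at most \<open>\<epsilon> / 2\<close>.\<close>
    define \<delta> where "\<delta> = min (r / 4) (\<epsilon> * r / (8 * M))"
    have \<delta>: "\<delta> > 0" "\<delta> \<le> r / 4" "\<delta> \<le> \<epsilon> * r / (8 * M)"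
      using r(1) M(1) \<epsilon> by (auto simp: \<delta>_def)
    have "2 * M * \<delta> / (r / 2) \<le> 2 * M * (\<epsilon> * r / (8 * M)) / (r / 2)"
      using \<delta>(3) r(1) M(1) by (intro divide_right_mono mult_left_mono) auto
    also have "\<dots> = \<epsilon> / 2" using r(1) M(1) by simp
    finally have error: "2 * M * \<delta> / (r / 2) < \<epsilon>" using \<epsilon> by linarith
    show "\<forall>\<^sub>F j in sequentially.
            dist (beta_function X T A (\<phi>s j) h) (beta_function X T A \<phi> h) < \<epsilon>"
      using close[OF \<delta>(1)]
    proof eventually_elim
      fix j assume j: "\<forall>x\<in>X. norm (\<phi> x - \<phi>s j x) \<le> \<delta>"
      note half_j = half[OF j less_imp_le[OF \<delta>(1)] \<delta>(2)]
      have r2: "0 < r / 2" and half: "cball h (r / 2) \<subseteq> ?rot \<phi>"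
        using r by auto
      have "beta_function X T A \<phi> h \<le> beta_function X T A (\<phi>s j) h + 2 * M * \<delta> / (r / 2)"
        by (rule beta_function_perturbed_le[OF X T A M(2) \<phi> \<phi>s])
          (use half half_j j \<delta>(1) r(1) in auto)
      moreover have "beta_function X T A (\<phi>s j) h \<le> beta_function X T A \<phi> h + 2 * M * \<delta> / (r / 2)"
        by (rule beta_function_perturbed_le[OF X T A M(2) \<phi>s \<phi>])
          (use half half_j j \<delta>(1) r(1) in \<open>auto simp: norm_minus_commute\<close>)
      ultimately show "dist (beta_function X T A (\<phi>s j) h) (beta_function X T A \<phi> h) < \<epsilon>"
        using error by (simp only: dist_real_def abs_less_iff) linarith
    qed
  qed
  ultimately show ?thesis ..
qed

end
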